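(* The pair $(\Phi,\phi)$ is a bundle isomorphism from the bundle $E\xrightarrow{\alpha_1}\Delta_n^m\times\Delta_m^\circ$ to the bundle $\bar E\xrightarrow{\bar\alpha}\Delta_{mn}^+$, i.e. $\phi:\Delta_n^m\times\Delta_m^\circ\to\Delta_{mn}^+$ and $\Phi:E\to\bar E$ are homeomorphisms with $\bar\alpha\circ\Phi=\phi\circ\alpha_1$.
   Context: Let $m,n$ be positive integers. $\Delta_n=\{x\in\mathbb{R}^n: x\ge 0,\ \mathbf 1^\top x=1\}$; $\Delta_n^m$ is the product of $m$ copies of $\Delta_n$, with elements $\pi=(\pi_1,\dots,\pi_m)\in\mathbb{R}^{m\times n}$. $\Delta_m^\circ=\{w\in\mathbb{R}^m: w_i>0\ \forall i,\ \sum_i w_i=1\}$. $\Delta_{mn}$ is the unit simplex in $\mathbb{R}^{mn}$; vectors of $\mathbb{R}^{mn}$ are written in $m$ blocks of length $n$, $\sigma=(\sigma_1,\dots,\sigma_m)$, and $\Delta_{mn}^+=\{\sigma\in\Delta_{mn}:\mathbf 1^\top\sigma_i>0\ \forall i\}$. $\mathrm{reshape}$ is the canonical identification between $\mathbb{R}^{m\times n}$ and $\mathbb{R}^{mn}$ (in either direction) sending rows to blocks. $[x_i]$ is the vector with entries $x_i$, $\mathrm{norm}([x_i])=[x_i]/\sum_j x_j$, $\circ$ between vectors is the componentwise product, and $w\odot\pi\in\mathbb{R}^{m\times n}$ is defined by $(w\odot\pi)_i=w_i\pi_i$. $F=(F_1,\dots,F_m):\Delta_n^m\to\mathbb{R}^{m\times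 n}$ is real-analytic, and $\tilde\tau(\pi)\in\mathbb{R}^{m\times n}$ is given by $\tilde\tau_i(\pi)=\pi_i\circ F_i(\pi)-(\pi_i^\top F_i(\pi))\pi_i$. The bundle $E$: $$\tilde B(\pi,w)=\{\tilde\tau(\pi)+\bar v\,w\odot\pi:\bar v\in\mathbb{R}\setminus\{0\}\},\quad B(\pi)=\bigcup_{w\in\Delta_m^\circ}\tilde B(\pi,w),\quad E=\bigcup_{\pi\in\Delta_n^m}\{\pi\}\times B(\pi),$$ with projection $\alpha_1:E\to\Delta_n^m\times\Delta_m^\circ$, $\alpha_1(\pi,\tau)=(\pi,\mathrm{norm}([\mathbf 1^\top\tau_i]))$. The map $\phi:\Delta_n^m\times\Delta_m^\circ\to\Delta_{mn}^+$ is $\phi(\pi,w)=\sigma$ with $\sigma_{i,a}=w_i\pi_{i,a}$; its inverse is $\phi^{-1}(\sigma)=(\phi^{-1}_\pi(\sigma),\phi^{-1}_w(\sigma))=(\pi,w)$ with $w_i=\sum_a\sigma_{i,a}$, $\pi_{i,a}=\sigma_{i,a}/\sum_a\sigma_{i,a}$. The bundle $\bar E$: $$\bar B(\sigma)=\{\mathrm{reshape}(\tilde\tau(\pi)+\bar v\,w\odot\pi):(\pi,w)=\phi^{-1}(\sigma),\ \bar v\in\mathbb{R}\setminus\{0\}\},\quad \bar E=\bigcup_{\sigma\in\Delta_{mn}^+}\{\sigma\}\times\bar B(\sigma),$$ with projection $\bar\alpha:\bar E\to\Delta_{mn}^+$, $\bar\alpha(\sigma,\mu)=\sigma$. The map $\Phi$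 is $\Phi(\pi,\tau)=(\sigma,\mu)$ with $\sigma=\phi(\pi,\mathrm{norm}([\mathbf 1^\top\tau_i]))$ and $\mu=\mathrm{reshape}(\tau)$; here it is considered on $E$. All sets carry the subspace topology. Given bundles $E\xrightarrow{\alpha}B$ and $E'\xrightarrow{\alpha'}B'$, a bundle isomorphism is a pair of homeomorphisms $(\Psi:E\to E',\ \psi:B\to B')$ with $\alpha'\circ\Psi=\psi\circ\alpha$. *)

theory Defs
  imports "HOL-Analysis.Analysis"
begin

text \<open>Real-analyticity on an arbitrary, not necessarily open, set \<open>S\<close>: around every point of \<open>S\<close>
  the function agrees on \<open>S\<close> with the sum of a multivariate power series that converges on a full
  ball of the ambient space. Multi-indices are the functions \<open>k\<close> from the basis to the naturals.
  Values of \<open>f\<close> outside \<open>S\<close> are irrelevant.\<close>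

definition real_analytic_on ::
  "('a::euclidean_space \<Rightarrow> 'b::euclidean_space) \<Rightarrow> 'a set \<Rightarrow> bool" (infixl \<open>real'_analytic'_on\<close> 50)
  where
  "f real_analytic_on S \<longleftrightarrow>
     (\<forall>x\<in>S. \<exists>r>0. \<exists>(c :: ('a \<Rightarrow> nat) \<Rightarrow> 'b) g.
        (\<forall>y\<in>ball x r.
           ((\<lambda>k. (\<Prod>b\<in>Basis. ((y - x) \<bullet> b) ^ k b) *\<^sub>R c k) has_sum g y) (Basis \<rightarrow>\<^sub>E UNIV)) \<and>
        (\<forall>y\<in>S \<inter> ball x r. f y = g y))"

definition unit_simplex :: "(real^'k) set" where
  "unit_simplex = {x. (\<forall>i. x $ i \<ge> 0) \<and> (\<Sum>i\<in>UNIV. x $ i) = 1}"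

definition open_simplex :: "(real^'k) set" where
  "open_simplex = {w. (\<forall>i. w $ i > 0) \<and> (\<Sum>i\<in>UNIV. w $ i) = 1}"

definition simplex_prod :: "(real^'n^'m) set" where
  "simplex_prod = {\<pi>. \<forall>i. \<pi> $ i \<in> unit_simplex}"

text \<open>Vectors of dimension \<open>m * n\<close> in \<open>m\<close> blocks of length \<open>n\<close> are indexed by pairs
  (block, position in the block).\<close>

definition simplex_plus :: "(real^('m::finite \<times> 'n::finite)) set" where
  "simplex_plus = {\<sigma> \<in> unit_simplex. \<forall>i. (\<Sum>a\<in>UNIV. \<sigma> $ (i, a)) > 0}"

definition reshape :: "real^'n^'m \<Rightarrow> real^('m \<times> 'n)" where
  "reshape \<tau> = (\<chi> p. \<tau> $ fst p $ snd p)"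

definition normalize_sum :: "real^'k \<Rightarrow> real^'k" where
  "normalize_sum x = (\<chi> i. x $ i / (\<Sum>j\<in>UNIV. x $ j))"

definition row_sums :: "real^'n^'m \<Rightarrow> real^'m" where
  "row_sums \<tau> = (\<chi> i. \<Sum>a\<in>UNIV. \<tau> $ i $ a)"

definition odot :: "real^'m \<Rightarrow> real^'n^'m \<Rightarrow> real^'n^'m" (infixl \<open>\<odot>\<close> 75) where
  "w \<odot> \<pi> = (\<chi> i. w $ i *\<^sub>R \<pi> $ i)"

text \<open>The product \<open>*\<close> of two vectors is the componentwise one.\<close>

definition tau_tilde :: "(real^'n^'m \<Rightarrow> real^'n^'m) \<Rightarrow> real^'n^'m \<Rightarrow> real^'n^'m" where
  "tau_tilde F \<pi> = (\<chi> i. \<pi> $ i * F \<pi> $ i - (\<pi> $ i \<bullet> F \<pi> $ i) *\<^sub>R \<pi> $ i)"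

definition B_tilde ::
  "(real^'n^'m \<Rightarrow> real^'n^'m) \<Rightarrow> real^'n^'m \<Rightarrow> real^'m \<Rightarrow> (real^'n^'m) set" where
  "B_tilde F \<pi> w = {tau_tilde F \<pi> + v *\<^sub>R (w \<odot> \<pi>) | v. v \<noteq> 0}"

definition B_fib :: "(real^'n^'m \<Rightarrow> real^'n^'m) \<Rightarrow> real^'n^'m \<Rightarrow> (real^'n^'m) set" where
  "B_fib F \<pi> = (\<Union>w\<in>open_simplex. B_tilde F \<pi> w)"

definition E_tot :: "(real^'n^'m \<Rightarrow> real^'n^'m) \<Rightarrow> ((real^'n^'m) \<times> (real^'n^'m)) set" where
  "E_tot F = (\<Union>\<pi>\<in>simplex_prod. {\<pi>} \<times> B_fib F \<pi>)"

definition alpha1 :: "(real^'n^'m) \<times> (real^'n^'m) \<Rightarrow> (real^'n^'m) \<times> (real^'m)" where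
  "alpha1 = (\<lambda>(\<pi>, \<tau>). (\<pi>, normalize_sum (row_sums \<tau>)))"

definition phi :: "(real^'n^'m) \<times> (real^'m) \<Rightarrow> real^('m \<times> 'n)" where
  "phi = (\<lambda>(\<pi>, w). \<chi> p. w $ fst p * \<pi> $ fst p $ snd p)"

definition phi_inv :: "real^('m \<times> 'n) \<Rightarrow> (real^'n^'m) \<times> (real^'m)" where
  "phi_inv \<sigma> = ((\<chi> i a. \<sigma> $ (i, a) / (\<Sum>b\<in>UNIV. \<sigma> $ (i, b))), (\<chi> i. \<Sum>a\<in>UNIV. \<sigma> $ (i, a)))"

definition B_bar ::
  "(real^'n^'m \<Rightarrow> real^'n^'m) \<Rightarrow> real^('m \<times> 'n) \<Rightarrow> (real^('m \<times> 'n)) set" where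
  "B_bar F \<sigma> = {reshape (tau_tilde F \<pi> + v *\<^sub>R (w \<odot> \<pi>)) | \<pi> w v. (\<pi>, w) = phi_inv \<sigma> \<and> v \<noteq> 0}"

definition E_bar ::
  "(real^'n^'m \<Rightarrow> real^'n^'m) \<Rightarrow> ((real^('m \<times> 'n)) \<times> (real^('m \<times> 'n))) set" where
  "E_bar F = (\<Union>\<sigma>\<in>simplex_plus. {\<sigma>} \<times> B_bar F \<sigma>)"

definition alpha_bar ::
  "(real^('m::finite \<times> 'n::finite)) \<times> (real^('m \<times> 'n)) \<Rightarrow> real^('m \<times> 'n)" where
  "alpha_bar = (\<lambda>(\<sigma>, \<mu>). \<sigma>)"

definition Phi ::
  "(real^'n^'m) \<times> (real^'n^'m) \<Rightarrow> (real^('m \<times> 'n)) \<times> (real^('m \<times> 'n))" where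
  "Phi = (\<lambda>(\<pi>, \<tau>). (phi (\<pi>, normalize_sum (row_sums \<tau>)), reshape \<tau>))"

text \<open>A bundle is a continuous map from the total space to the base; no local triviality is
  required.\<close>

definition is_bundle ::
  "'e::topological_space set \<Rightarrow> ('e \<Rightarrow> 'b) \<Rightarrow> 'b::topological_space set \<Rightarrow> bool" where
  "is_bundle E \<alpha> B \<longleftrightarrow> continuous_on E \<alpha> \<and> \<alpha> \<in> E \<rightarrow> B"

definition bundle_isomorphism ::
  "'e::topological_space set \<Rightarrow> ('e \<Rightarrow> 'b) \<Rightarrow> 'b::topological_space set \<Rightarrow>
   'f::topological_space set \<Rightarrow> ('f \<Rightarrow> 'c) \<Rightarrow> 'c::topological_space set \<Rightarrow>
   ('e \<Rightarrow> 'f) \<Rightarrow> ('b \<Rightarrow> 'c) \<Rightarrow> bool" where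
  "bundle_isomorphism E \<alpha> B E' \<alpha>' B' \<Psi> \<psi> \<longleftrightarrow>
     is_bundle E \<alpha> B \<and> is_bundle E' \<alpha>' B' \<and>
     (\<exists>\<Psi>'. homeomorphism E E' \<Psi> \<Psi>') \<and>
     (\<exists>\<psi>'. homeomorphism B B' \<psi> \<psi>') \<and>
     (\<forall>e\<in>E. \<alpha>' (\<Psi> e) = \<psi> (\<alpha> e))"

end

theory Submission
  imports Defs
begin

text \<open>On \<open>simplex_prod\<close> each row of \<open>tau_tilde F \<pi>\<close> sums to zero, so a fibre element
  \<open>\<tau> = tau_tilde F \<pi> + v *\<^sub>R (w \<odot> \<pi>)\<close> has row sums \<open>v *\<^sub>R w\<close>; as \<open>v \<noteq> 0\<close>, normalising recovers
  \<open>w\<close> continuously. Hence \<open>Phi\<close> is \<open>phi\<close> on the base and a linear isomorphism on the fibres, and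
  its inverse sends \<open>(\<sigma>, \<mu>)\<close> to the first component of \<open>phi_inv \<sigma>\<close> and the unreshaped \<open>\<mu>\<close>.\<close>

text \<open>Turns the total mass of a vector indexed by pairs into a sum of block sums, which are
  the weights.\<close>

lemma sum_pairs: "(\<Sum>p\<in>UNIV. f p) = (\<Sum>i\<in>UNIV. \<Sum>a\<in>UNIV. f (i::'m::finite, a::'n::finite))"
  by (simp add: sum.cartesian_product split_beta)

lemma simplex_prod_row_sum: "\<pi> \<in> simplex_prod \<Longrightarrow> (\<Sum>a\<in>UNIV. \<pi> $ i $ a) = 1"
  by (simp add: simplex_prod_def unit_simplex_def)

text \<open>With \<open>s = \<pi> $ i \<bullet> F \<pi> $ i\<close>, row \<open>i\<close> of
  \<open>tau_tilde F \<pi>\<close> sums to \<open>s - s * 1 = 0\<close>, while row \<open>i\<close>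
  of \<open>w \<odot> \<pi>\<close> sums to \<open>w $ i\<close>.\<close>

lemma row_sums_fibre:
  fixes \<pi> :: "real^'n^'m"
  assumes "\<pi> \<in> simplex_prod"
  shows "row_sums (tau_tilde F \<pi> + v *\<^sub>R (w \<odot> \<pi>)) = v *\<^sub>R w"
  using assms
  by (simp add: row_sums_def tau_tilde_def odot_def vec_eq_iff sum.distrib sum_subtractf
      inner_vec_def simplex_prod_row_sum flip: sum_distrib_left)

text \<open>The entries of \<open>v *\<^sub>R w\<close> total \<open>v\<close>, which cancels
  whatever its sign.\<close>

lemma normalize_sum_scale:
  assumes "v \<noteq> 0" "w \<in> open_simplex"
  shows "normalize_sum (v *\<^sub>R w) = w"
  using assms
  by (simp add: normalize_sum_def open_simplex_def vec_eq_iff flip: sum_distrib_left)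

lemma E_totE:
  assumes "e \<in> E_tot F"
  obtains \<pi> w v where "\<pi> \<in> simplex_prod" "w \<in> open_simplex" "v \<noteq> 0"
    "e = (\<pi>, tau_tilde F \<pi> + v *\<^sub>R (w \<odot> \<pi>))"
  using assms unfolding E_tot_def B_fib_def B_tilde_def by blast

lemma E_totI:
  assumes "\<pi> \<in> simplex_prod" "w \<in> open_simplex" "v \<noteq> 0"
  shows "(\<pi>, tau_tilde F \<pi> + v *\<^sub>R (w \<odot> \<pi>)) \<in> E_tot F"
  using assms unfolding E_tot_def B_fib_def B_tilde_def by blast

lemma alpha1_fibre:
  assumes "\<pi> \<in> simplex_prod" "w \<in> open_simplex" "v \<noteq> 0"
  shows "alpha1 (\<pi>, tau_tilde F \<pi> + v *\<^sub>R (w \<odot> \<pi>)) = (\<pi>, w)"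
  using assms by (simp add: alpha1_def row_sums_fibre normalize_sum_scale)

text \<open>This factorisation reduces continuity of \<open>Phi\<close> to that of
  \<open>alpha1\<close> and makes compatibility with the projections immediate.\<close>

lemma Phi_eq: "Phi e = (phi (alpha1 e), reshape (snd e))"
  by (simp add: Phi_def alpha1_def split_beta)

lemma alpha1_in_base: "alpha1 \<in> E_tot F \<rightarrow> simplex_prod \<times> open_simplex"
  by (auto elim!: E_totE simp: alpha1_fibre)

lemma continuous_on_alpha1:
  fixes F :: "real^'n^'m \<Rightarrow> real^'n^'m"
  shows "continuous_on (E_tot F) alpha1"
proof -
  \<comment> \<open>This total is the denominator in \<open>normalize_sum\<close>; on a fibre it
    equals the parameter \<open>v\<close>.\<close>
  have "(\<Sum>j\<in>UNIV. \<Sum>a\<in>UNIV. snd e $ j $ a) \<noteq> 0" if "e \<in> E_tot F" for e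
    using that
  proof (rule E_totE)
    fix \<pi> :: "real^'n^'m" and w v
    assume *: "\<pi> \<in> simplex_prod" "w \<in> open_simplex" "v \<noteq> 0"
      "e = (\<pi>, tau_tilde F \<pi> + v *\<^sub>R (w \<odot> \<pi>))"
    have "(\<Sum>j\<in>UNIV. \<Sum>a\<in>UNIV. snd e $ j $ a) = (\<Sum>j\<in>UNIV. row_sums (snd e) $ j)"
      by (simp add: row_sums_def)
    also have "\<dots> = v"
      using * by (simp add: row_sums_fibre open_simplex_def flip: sum_distrib_left)
    finally show ?thesis using * by simp
  qed
  then show ?thesis
    unfolding alpha1_def normalize_sum_def row_sums_def split_beta vec_lambda_beta
    by (intro continuous_intros) auto
qed

lemma phi_in_simplex_plus:
  assumes "\<pi> \<in> simplex_prod" "w \<in> open_simplex"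
  shows "phi (\<pi>, w) \<in> simplex_plus"
  using assms
  by (auto simp: phi_def simplex_plus_def unit_simplex_def open_simplex_def sum_pairs
      simplex_prod_def less_imp_le simp flip: sum_distrib_left)

lemma phi_inv_in_base:
  assumes "\<sigma> \<in> simplex_plus"
  shows "phi_inv \<sigma> \<in> simplex_prod \<times> open_simplex"
  using assms
  by (auto simp: phi_inv_def simplex_plus_def unit_simplex_def open_simplex_def sum_pairs
      simplex_prod_def less_imp_le less_imp_neq[symmetric] simp flip: sum_divide_distrib
      intro!: divide_nonneg_pos)

text \<open>Block \<open>i\<close> of the image sums to \<open>w $ i\<close>, since row
  \<open>i\<close> of \<pi> sums to 1; dividing by this positive weight returns the row.\<close>

lemma phi_inv_phi:
  assumes "\<pi> \<in> simplex_prod" "w \<in> open_simplex"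
  shows "phi_inv (phi (\<pi>, w)) = (\<pi>, w)"
  using assms
  by (simp add: phi_def phi_inv_def open_simplex_def simplex_prod_row_sum vec_eq_iff
      less_imp_neq[symmetric] flip: sum_distrib_left)

lemma phi_phi_inv:
  assumes "\<sigma> \<in> simplex_plus"
  shows "phi (phi_inv \<sigma>) = \<sigma>"
  using assms
  by (simp add: phi_def phi_inv_def simplex_plus_def vec_eq_iff less_imp_neq[symmetric])

lemma continuous_on_phi: "continuous_on S phi"
  unfolding phi_def split_beta by (intro continuous_intros)

lemma continuous_on_phi_inv: "continuous_on simplex_plus phi_inv"
  unfolding phi_inv_def
  by (intro continuous_intros) (auto simp: simplex_plus_def less_imp_neq[symmetric])

lemma homeomorphism_phi:
  "homeomorphism (simplex_prod \<times> open_simplex) simplex_plus phi phi_inv"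
  by (rule homeomorphismI)
    (auto simp: continuous_on_phi continuous_on_phi_inv phi_in_simplex_plus phi_inv_phi
      phi_phi_inv dest: phi_inv_in_base)

text \<open>Writing \<sigma> as \<open>phi (\<pi>, w)\<close> describes \<open>E_bar F\<close> by
  the same triples \<open>(\<pi>, w, v)\<close> as \<open>E_tot F\<close>.\<close>

lemma E_barE:
  assumes "e \<in> E_bar F"
  obtains \<pi> w v where "\<pi> \<in> simplex_prod" "w \<in> open_simplex" "v \<noteq> 0"
    "e = (phi (\<pi>, w), reshape (tau_tilde F \<pi> + v *\<^sub>R (w \<odot> \<pi>)))"
proof -
  from assms obtain \<sigma> \<pi> w v where *: "\<sigma> \<in> simplex_plus" "(\<pi>, w) = phi_inv \<sigma>" "v \<noteq> 0"
    "e = (\<sigma>, reshape (tau_tilde F \<pi> + v *\<^sub>R (w \<odot> \<pi>)))"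
    unfolding E_bar_def B_bar_def by blast
  with phi_inv_in_base[of \<sigma>] phi_phi_inv[of \<sigma>] show thesis
    using that[of \<pi> w v] by (metis mem_Sigma_iff)
qed

lemma E_barI:
  assumes "\<pi> \<in> simplex_prod" "w \<in> open_simplex" "v \<noteq> 0"
  shows "(phi (\<pi>, w), reshape (tau_tilde F \<pi> + v *\<^sub>R (w \<odot> \<pi>))) \<in> E_bar F"
  using assms phi_in_simplex_plus[of \<pi> w] phi_inv_phi[of \<pi> w]
  unfolding E_bar_def B_bar_def by fastforce

definition unreshape :: "real^('m \<times> 'n) \<Rightarrow> real^'n^'m" where
  "unreshape \<mu> = (\<chi> i a. \<mu> $ (i, a))"

lemma unreshape_reshape [simp]: "unreshape (reshape \<tau>) = \<tau>"
  by (simp add: unreshape_def reshape_def)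

lemma continuous_on_reshape: "continuous_on S reshape"
  unfolding reshape_def by (intro continuous_intros)

lemma continuous_on_unreshape: "continuous_on S unreshape"
  unfolding unreshape_def by (intro continuous_intros)

text \<open>The weights in \<open>phi_inv \<sigma>\<close> are dropped: on \<open>E_bar F\<close>
  they are still encoded in the row sums of \<open>unreshape \<mu>\<close>.\<close>

definition Phi_inv ::
  "(real^('m \<times> 'n)) \<times> (real^('m \<times> 'n)) \<Rightarrow> (real^'n^'m) \<times> (real^'n^'m)" where
  "Phi_inv = (\<lambda>(\<sigma>, \<mu>). (fst (phi_inv \<sigma>), unreshape \<mu>))"

lemma Phi_fibre:
  assumes "\<pi> \<in> simplex_prod" "w \<in> open_simplex" "v \<noteq> 0"
  shows "Phi (\<pi>, tau_tilde F \<pi> + v *\<^sub>R (w \<odot> \<pi>)) =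
    (phi (\<pi>, w), reshape (tau_tilde F \<pi> + v *\<^sub>R (w \<odot> \<pi>)))"
  using assms by (simp add: Phi_eq alpha1_fibre)

lemma Phi_inv_fibre:
  assumes "\<pi> \<in> simplex_prod" "w \<in> open_simplex"
  shows "Phi_inv (phi (\<pi>, w), reshape \<tau>) = (\<pi>, \<tau>)"
  using assms by (simp add: Phi_inv_def phi_inv_phi)

lemma continuous_on_Phi: "continuous_on (E_tot F) Phi"
  unfolding Phi_eq[abs_def]
  by (intro continuous_on_Pair continuous_on_compose2[OF continuous_on_phi continuous_on_alpha1]
      continuous_on_compose2[OF continuous_on_reshape continuous_on_snd[OF continuous_on_id]])
    auto

lemma continuous_on_Phi_inv: "continuous_on (E_bar F) Phi_inv"
proof -
  \<comment> \<open>Continuity of \<open>phi_inv\<close> is available only on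
    \<open>simplex_plus\<close>, where the block sums it divides by are positive.\<close>
  have "fst ` E_bar F \<subseteq> simplex_plus"
    by (auto simp: E_bar_def)
  then show ?thesis
    unfolding Phi_inv_def split_beta
    by (intro continuous_on_Pair continuous_on_fst
        continuous_on_compose2[OF continuous_on_phi_inv continuous_on_fst[OF continuous_on_id]]
        continuous_on_compose2[OF continuous_on_unreshape continuous_on_snd[OF continuous_on_id]])
      auto
qed

text \<open>In terms of the triples \<open>(\<pi>, w, v)\<close> describing both total spaces,
  \<open>Phi\<close> and \<open>Phi_inv\<close> act as the identity.\<close>

lemma homeomorphism_Phi: "homeomorphism (E_tot F) (E_bar F) Phi Phi_inv"
  by (rule homeomorphismI)
    (auto simp: continuous_on_Phi continuous_on_Phi_inv Phi_fibre Phi_inv_fibre E_totI E_barI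
      elim!: E_totE E_barE)

lemma is_bundle_alpha_bar: "is_bundle (E_bar F) alpha_bar simplex_plus"
  unfolding is_bundle_def alpha_bar_def split_beta
  by (auto simp: E_bar_def intro!: continuous_intros)

theorem theorem7:
  fixes F :: "real^'n^'m \<Rightarrow> real^'n^'m"
  assumes "F real_analytic_on simplex_prod"
  shows "bundle_isomorphism
           (E_tot F) alpha1 (simplex_prod \<times> open_simplex)
           (E_bar F) alpha_bar simplex_plus
           Phi phi"
  unfolding bundle_isomorphism_def
proof (intro conjI ballI)
  show "is_bundle (E_tot F) alpha1 (simplex_prod \<times> open_simplex)"
    by (simp add: is_bundle_def continuous_on_alpha1 alpha1_in_base)
  show "\<exists>\<Psi>'. homeomorphism (E_tot F) (E_bar F) Phi \<Psi>'"
    using homeomorphism_Phi by blast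
  show "\<exists>\<psi>'. homeomorphism (simplex_prod \<times> open_simplex) simplex_plus phi \<psi>'"
    using homeomorphism_phi by blast
  show "alpha_bar (Phi e) = phi (alpha1 e)" for e
    by (simp add: alpha_bar_def Phi_eq)
qed (rule is_bundle_alpha_bar)

end
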